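(* For every $n\in\mathbb{N}$, the Changhee polynomials of the first kind satisfy $$Ch_n(x)=\sum_{i=0}^n (-1)^i\,\frac{n!}{2^i}\binom{x}{n-i}.$$
   Context: The Changhee polynomials of the first kind $Ch_n(x)$, $n\ge 0$, are defined by the generating function (an identity of formal power series in $t$, with $x$ an indeterminate) $$\sum_{n=0}^\infty Ch_n(x)\frac{t^n}{n!}=\left(\frac{2}{2+t}\right)(1+t)^x .$$ Here $\binom{x}{j}=\frac{x(x-1)\cdots(x-j+1)}{j!}$ is the generalized binomial coefficient (a polynomial in $x$), with $\binom{x}{0}=1$, and $(1+t)^x=\sum_{j\ge 0}\binom{x}{j}t^j$. $\mathbb{N}$ denotes the positive integers. *)

theory Defs
  imports "HOL-Computational_Algebra.Computational_Algebra"
begin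

text \<open>The library admits \<open>(gchoose)\<close> only on fields of characteristic zero, hence not on the
  indeterminate \<open>[:0, 1:]\<close> of \<open>'a poly\<close>.\<close>

definition gbinomial_poly :: "nat \<Rightarrow> 'a::field_char_0 poly" where
  "gbinomial_poly j = smult (1 / fact j) (\<Prod>i = 0..<j. [:0, 1:] - of_nat i)"

lemma poly_gbinomial_poly: "poly (gbinomial_poly j) a = a gchoose j"
  by (simp add: gbinomial_poly_def gbinomial_prod_rev poly_prod)

definition one_plus_t_power_x :: "'a::field_char_0 poly fps" where
  "one_plus_t_power_x = Abs_fps gbinomial_poly"

text \<open>Since \<open>'a poly\<close> is not a field, the library has no division on \<open>'a poly fps\<close>. The series
  \<open>2 / (2 + t)\<close> is therefore formed over the ground field and then embedded coefficientwise;
  the lemma below states that the result is the quotient in \<open>'a poly fps\<close>.\<close>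

definition const_poly_fps :: "'a::zero fps \<Rightarrow> 'a poly fps" where
  "const_poly_fps f = Abs_fps (\<lambda>n. [:fps_nth f n:])"

lemma const_poly_fps_quotient:
  "(2 + fps_X) * const_poly_fps (2 / (2 + fps_X) :: 'a::field_char_0 fps) = 2"
proof -
  define f :: "'a fps" where "f = 2 / (2 + fps_X)"
  have "fps_nth (2 + fps_X :: 'a fps) 0 \<noteq> 0"
    by (simp add: fps_numeral_nth_0)
  then have f: "(2 + fps_X) * f = 2"
    unfolding f_def by (metis fps_nonzero_nth dvd_mult_div_cancel fps_is_unit_iff unit_imp_dvd)
  have mult: "const_poly_fps (g * h) = const_poly_fps g * const_poly_fps h" for g h :: "'a fps"
    by (rule fps_ext) (simp add: const_poly_fps_def fps_mult_nth sum_to_poly mult.commute)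
  have two: "const_poly_fps (2 :: 'a fps) = 2"
    by (rule fps_ext) (simp add: const_poly_fps_def fps_numeral_nth numeral_poly)
  have "const_poly_fps (2 + fps_X :: 'a fps) = 2 + fps_X"
    by (rule fps_ext) (auto simp: const_poly_fps_def fps_numeral_nth numeral_poly one_pCons)
  then show ?thesis
    using mult[of "2 + fps_X" f] f two by (simp add: f_def)
qed

definition Changhee_poly :: "nat \<Rightarrow> 'a::field_char_0 poly" where
  "Changhee_poly n =
     smult (fact n) (fps_nth (const_poly_fps (2 / (2 + fps_X)) * one_plus_t_power_x) n)"

lemma Changhee_poly_generating_function:
  "Abs_fps (\<lambda>n. smult (1 / fact n) (Changhee_poly n)) =
     const_poly_fps (2 / (2 + fps_X) :: 'a::field_char_0 fps) * one_plus_t_power_x"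
  by (rule fps_ext) (simp add: Changhee_poly_def)

end

theory Submission imports Defs begin

text \<open>The factor \<open>2 / (2 + t) = 1 / (1 + t / 2)\<close> is the geometric series with ratio \<open>- t / 2\<close>,
  so its \<open>i\<close>-th coefficient is \<open>(- 1 / 2) ^ i\<close>. The formula is then the Cauchy product of this
  series with \<open>(1 + t) ^ x\<close>, whose coefficients are the binomial polynomials, read off at
  \<open>t ^ n\<close> and multiplied by \<open>n!\<close>.\<close>

text \<open>Multiplying the geometric series by \<open>2 + t\<close> makes all coefficients beyond the constant one
  cancel in pairs, and \<open>2 + t\<close> may be cancelled because it is nonzero.\<close>

lemma two_div_two_plus_fps_X:
  "2 / (2 + fps_X) = Abs_fps (\<lambda>i. (- 1 / 2) ^ i :: 'a::field_char_0)"
proof -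
  define A :: "'a fps" where "A = Abs_fps (\<lambda>i. (- 1 / 2) ^ i)"
  have "(2 + fps_X) * A = 2"
  proof (rule fps_ext)
    fix n
    show "fps_nth ((2 + fps_X) * A) n = fps_nth 2 n"
      by (cases n) (simp_all add: A_def distrib_right numeral_fps_const)
  qed
  moreover have "(2 + fps_X :: 'a fps) \<noteq> 0"
    by (rule fps_nonzeroI[of _ 0]) (simp add: fps_numeral_nth_0)
  ultimately have "2 / (2 + fps_X) = A"
    by (metis nonzero_mult_div_cancel_left)
  then show ?thesis
    by (simp add: A_def)
qed

theorem theorem2p3:
  fixes n :: nat
  assumes "n \<ge> 1"
  shows "(Changhee_poly n :: 'a::field_char_0 poly) =
    (\<Sum>i = 0..n. smult ((- 1) ^ i * (fact n / 2 ^ i)) (gbinomial_poly (n - i)))"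
proof -
  have "(Changhee_poly n :: 'a poly) =
      (\<Sum>i = 0..n. smult (fact n * (- 1 / 2) ^ i) (gbinomial_poly (n - i)))"
    by (rule poly_eqI) (simp add: Changhee_poly_def two_div_two_plus_fps_X const_poly_fps_def
        one_plus_t_power_x_def fps_mult_nth coeff_sum sum_distrib_left mult.assoc)
  also have "\<dots> = (\<Sum>i = 0..n. smult ((- 1) ^ i * (fact n / 2 ^ i)) (gbinomial_poly (n - i)))"
    by (simp only: power_divide times_divide_eq_right mult.commute)
  finally show ?thesis .
qed

end
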